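(* Let $G$ be a countably infinite amenable group, let $(H,\tau)$ be a metric group compactification of $G$ with normalized Haar measure $\nu$, and let $\mathfrak{B}(H)$ be the set of Borel-measurable subsets of $H$. For $A,B\in\mathfrak{B}(H)$ put $$D(A,B)=\nu(A\triangle B),\qquad \overline{D}(A,B)=\nu\big(\overline{A\triangle B}\big).$$ Then $D$ and $\overline{D}$ are pseudometrics on $\mathfrak{B}(H)$. Moreover, let $\mathcal{F}$ be a Følner sequence in $G$, equip $\{0,1\}^G$ with the Besicovitch pseudometric $D_{\mathcal{F}}$, and let $\Phi:\mathfrak{B}(H)\to\{0,1\}^G$, $\Phi(W)=x_W:=\mathbf{1}_W\circ\tau$. Then: (1) The map $\Phi$ is continuous with respect to $\overline{D}$ on $\mathfrak{B}(H)$ and $D_{\mathcal{F}}$ on $\{0,1\}^G$. (2) The restriction of $\Phi$ to the regular windows $\{W\in\mathfrak{B}(H):\nu(\partial W)=0\}$ is an isometry between $D$ and $D_{\mathcal{F}}$, i.e. $D_{\mathcal{F}}(x_W,x_{W'})=D(W,W')$ for all regular windows $W,W'$. Moreover, (1) and (2) also hold with $D_{\mathcal{F}}$ replaced by the Weyl pseudometric $D_{\mathrm{Weyl}}$.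
   Context: A metric group compactification $(H,\tau)$ of $G$ consists of a compact metrizable group $H$ and an injective group homomorphism $\tau:G\to H$ with dense range. $\triangle$ is symmetric difference, $\overline{A}$ is closure, $\partial A$ is topological boundary, $\mathbf{1}_W$ is the indicator function of $W$. A Følner sequence in $G$ is a sequence $\mathcal{F}=(F_n)_{n\in\mathbb{N}}$ of nonempty finite subsets of $G$ with $\#(gF_n\triangle F_n)/\#F_n\to0$ for every $g\in G$. The Besicovitch pseudometric is $D_{\mathcal{F}}(x,y)=\limsup_{n\to\infty}\frac{1}{\#F_n}\#\{g\in F_n: x(g)\neq y(g)\}$ for $x,y\in\{0,1\}^G$. The Weyl pseudometric is $D_{\mathrm{Weyl}}(x,y)=\sup_{\mathcal{F}}D_{\mathcal{F}}(x,y)$, the supremum being over all Følner sequences in $G$. *)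

theory Defs
  imports "HOL-Analysis.Analysis" "HOL-Library.Z2"
begin

text \<open>
  Groups are written additively, as in the library classes \<^class>\<open>group_add\<close> and
  \<^class>\<open>topological_group_add\<close>; neither class assumes commutativity, and \<open>(+) g\<close> is
  left translation by \<open>g\<close>. The discrete group \<open>G\<close> is the type \<open>'g\<close>. A metrizable group \<open>H\<close> is
  a type \<open>'h\<close> in both \<^class>\<open>topological_group_add\<close> and \<^class>\<open>metric_space\<close>: the metric is some
  metric inducing the topology, with no invariance assumed, and it is never used below
  other than through the topology.
\<close>

definition folner_sequence :: "(nat \<Rightarrow> 'g::group_add set) \<Rightarrow> bool" where
  "folner_sequence F \<longleftrightarrow>
     (\<forall>n. finite (F n) \<and> F n \<noteq> {}) \<and>
     (\<forall>g. (\<lambda>n. real (card (sym_diff ((+) g ` F n) (F n))) / real (card (F n))) \<longlonglongrightarrow> 0)"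

text \<open>Amenability of a countable discrete group is the existence of a Folner sequence. The
  argument only selects the group.\<close>

definition amenable_group :: "'g::group_add itself \<Rightarrow> bool" where
  "amenable_group _ \<longleftrightarrow> (\<exists>F :: nat \<Rightarrow> 'g set. folner_sequence F)"

definition metric_group_compactification ::
    "('g::group_add \<Rightarrow> 'h::{topological_group_add, metric_space}) \<Rightarrow> bool" where
  "metric_group_compactification \<tau> \<longleftrightarrow>
     compact (UNIV :: 'h set) \<and>
     (\<forall>g g'. \<tau> (g + g') = \<tau> g + \<tau> g') \<and> inj \<tau> \<and> closure (range \<tau>) = UNIV"

text \<open>Regularity is not listed as a requirement since every finite Borel measure on a metric
  space is regular in the sense of approximation by closed and open sets.\<close>

definition normalized_haar_measure :: "'h::{topological_group_add, metric_space} measure \<Rightarrow> bool" where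
  "normalized_haar_measure \<nu> \<longleftrightarrow>
     sets \<nu> = sets borel \<and> emeasure \<nu> UNIV = 1 \<and>
     (\<forall>h. \<forall>A\<in>sets borel. emeasure \<nu> ((+) h ` A) = emeasure \<nu> A)"

definition pseudometric_on :: "'a set \<Rightarrow> ('a \<Rightarrow> 'a \<Rightarrow> real) \<Rightarrow> bool" where
  "pseudometric_on S d \<longleftrightarrow>
     (\<forall>x\<in>S. \<forall>y\<in>S. 0 \<le> d x y) \<and> (\<forall>x\<in>S. d x x = 0) \<and>
     (\<forall>x\<in>S. \<forall>y\<in>S. d x y = d y x) \<and>
     (\<forall>x\<in>S. \<forall>y\<in>S. \<forall>z\<in>S. d x z \<le> d x y + d y z)"

definition pseudometric_continuous_on ::
    "'a set \<Rightarrow> ('a \<Rightarrow> 'a \<Rightarrow> real) \<Rightarrow> ('b \<Rightarrow> 'b \<Rightarrow> real) \<Rightarrow> ('a \<Rightarrow> 'b) \<Rightarrow> bool" where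
  "pseudometric_continuous_on S d e f \<longleftrightarrow>
     (\<forall>x\<in>S. \<forall>\<epsilon>>0. \<exists>\<delta>>0. \<forall>y\<in>S. d x y < \<delta> \<longrightarrow> e (f x) (f y) < \<epsilon>)"

definition pseudometric_isometry_on ::
    "'a set \<Rightarrow> ('a \<Rightarrow> 'a \<Rightarrow> real) \<Rightarrow> ('b \<Rightarrow> 'b \<Rightarrow> real) \<Rightarrow> ('a \<Rightarrow> 'b) \<Rightarrow> bool" where
  "pseudometric_isometry_on S d e f \<longleftrightarrow> (\<forall>x\<in>S. \<forall>y\<in>S. e (f x) (f y) = d x y)"

text \<open>The two-element type \<^typ>\<open>bit\<close> plays the role of \<open>{0,1}\<close>. The limit superior is taken in the
  complete lattice \<^typ>\<open>ereal\<close>; for a Folner sequence the quotients lie in \<open>[0,1]\<close>, so nothing is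
  lost in passing back to \<^typ>\<open>real\<close>.\<close>

definition besicovitch :: "(nat \<Rightarrow> 'g set) \<Rightarrow> ('g \<Rightarrow> bit) \<Rightarrow> ('g \<Rightarrow> bit) \<Rightarrow> real" where
  "besicovitch F x y =
     real_of_ereal (limsup (\<lambda>n. ereal (real (card {g \<in> F n. x g \<noteq> y g}) / real (card (F n)))))"

text \<open>The set under the supremum is contained in \<open>[0,1]\<close>, and is nonempty when the group is amenable.\<close>

definition weyl :: "('g::group_add \<Rightarrow> bit) \<Rightarrow> ('g \<Rightarrow> bit) \<Rightarrow> real" where
  "weyl x y = (SUP F\<in>{F. folner_sequence F}. besicovitch F x y)"

definition window_dist :: "'h measure \<Rightarrow> 'h set \<Rightarrow> 'h set \<Rightarrow> real" where
  "window_dist \<nu> A B = measure \<nu> (sym_diff A B)"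

definition window_closure_dist :: "'h::topological_space measure \<Rightarrow> 'h set \<Rightarrow> 'h set \<Rightarrow> real" where
  "window_closure_dist \<nu> A B = measure \<nu> (closure (sym_diff A B))"

definition coding :: "('g \<Rightarrow> 'h) \<Rightarrow> 'h set \<Rightarrow> 'g \<Rightarrow> bit" where
  "coding \<tau> W = indicator W \<circ> \<tau>"

definition regular_windows :: "'h::topological_space measure \<Rightarrow> 'h set set" where
  "regular_windows \<nu> = {W \<in> sets borel. measure \<nu> (frontier W) = 0}"

end

theory Submission
  imports Defs
begin

text \<open>
  The points at which the codings of two windows differ are the \<open>g\<close> with \<open>\<tau> g\<close> in the
  symmetric difference of the windows, so their Besicovitch distance along a Folner sequence \<open>F\<close>
  is the upper frequency with which \<open>\<tau>\<close>, sampled along \<open>F\<close>, visits a Borel set \<open>S\<close>. Everything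
  rests on the equidistribution of \<open>\<tau>\<close>: for continuous \<open>q\<close> on \<open>H\<close>, the means of \<open>q (\<tau> g)\<close> over
  \<open>F n\<close> tend to \<open>\<integral> q d\<nu>\<close> (\<open>mean_tendsto_integral\<close>).

  Granting this, approximating a closed set from above by continuous functions shows that its
  upper frequency is at most its measure. Hence the upper frequency of any \<open>S\<close> is at most the
  measure of the closure of \<open>S\<close>, so that the coding does not increase distances when windows are
  compared by \<open>window_closure_dist\<close>; this gives continuity. If the boundary of \<open>S\<close> is null, the
  same bound for \<open>S\<close> and for its complement makes the frequency of \<open>S\<close> converge to the measure of
  \<open>S\<close>, and the symmetric difference of two regular windows is of this kind; this gives the
  isometry. As these bounds are the same for all Folner sequences, they pass to the supremum
  that defines the Weyl pseudometric.

  Equidistribution is proved by elementary averaging, without weak limits of measures, without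
  uniqueness of Haar measure and without product measures. The Folner property makes the means
  of \<open>q (h + \<tau> g)\<close> asymptotically independent of \<open>h\<close>, first for \<open>h\<close> in the range of \<open>\<tau>\<close> and then,
  by density and uniform continuity, for all \<open>h\<close>. Integrating over \<open>h\<close> identifies their limit.
  Since \<open>\<nu>\<close> is only known to be left invariant and \<open>h\<close> stands on the left of \<open>\<tau> g\<close>, the
  integral can be evaluated only after replacing \<open>h\<close> by \<open>- h\<close>, and the limit comes out as
  \<open>\<integral> q (- x) d\<nu>\<close> (\<open>mean_tendsto_integral_uminus\<close>). A second averaging, now with \<open>h\<close> on the right
  of \<open>\<tau> g\<close>, shows that \<open>\<nu>\<close> is invariant under inversion (\<open>integral_uminus\<close>).
\<close>

section \<open>Means over finite sets and Folner sequences\<close>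

definition mean :: "'a set \<Rightarrow> ('a \<Rightarrow> real) \<Rightarrow> real" where
  "mean F p = (\<Sum>g\<in>F. p g) / real (card F)"

lemma mean_const: "finite F \<Longrightarrow> F \<noteq> {} \<Longrightarrow> mean F (\<lambda>_. c) = c"
  by (simp add: mean_def)

lemma mean_diff: "mean F (\<lambda>g. p g - q g) = mean F p - mean F q"
  by (simp add: mean_def sum_subtractf diff_divide_distrib)

lemma mean_mono: "(\<And>g. g \<in> F \<Longrightarrow> p g \<le> q g) \<Longrightarrow> mean F p \<le> mean F q"
  by (simp add: mean_def sum_mono divide_right_mono)

lemma abs_mean_le:
  assumes "finite F" "F \<noteq> {}" "\<And>g. g \<in> F \<Longrightarrow> \<bar>p g\<bar> \<le> c"
  shows "\<bar>mean F p\<bar> \<le> c"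
proof -
  have "mean F p \<le> mean F (\<lambda>_. c)" "mean F (\<lambda>_. - c) \<le> mean F p"
    using assms(3) by (auto intro!: mean_mono simp: abs_le_iff minus_le_iff)
  then show ?thesis using assms by (simp add: mean_const)
qed

lemma mean_indicator:
  "finite F \<Longrightarrow> mean F (\<lambda>g. indicator S (t g)) = real (card {g \<in> F. t g \<in> S}) / real (card F)"
  unfolding mean_def indicator_def
  by (simp add: sum.If_cases Int_def)

text \<open>Left translating the argument changes a sum only by the terms over the symmetric
  difference of the translated set and the original one; this is where the Folner property enters.\<close>

lemma mean_translate_diff_le:
  fixes p :: "'g::group_add \<Rightarrow> real"
  assumes "finite F" and "\<And>g. \<bar>p g\<bar> \<le> M"
  shows "\<bar>mean F (\<lambda>g. p (k + g)) - mean F p\<bar>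
           \<le> M * (real (card (sym_diff ((+) k ` F) F)) / real (card F))"
proof -
  let ?K = "(+) k ` F"
  have "(\<Sum>g\<in>F. p (k + g)) = sum p ?K"
    by (subst sum.reindex) (auto simp: inj_on_def)
  moreover have "sum p ?K = sum p (?K \<inter> F) + sum p (?K - F)"
    using assms(1) by (intro sum.Int_Diff) simp
  moreover have "sum p F = sum p (?K \<inter> F) + sum p (F - ?K)"
    using assms(1) by (subst Int_commute) (rule sum.Int_Diff)
  ultimately have eq: "(\<Sum>g\<in>F. p (k + g)) - sum p F = sum p (?K - F) - sum p (F - ?K)" by simp
  have "\<bar>sum p (?K - F) - sum p (F - ?K)\<bar> \<le> (\<Sum>g\<in>?K - F. \<bar>p g\<bar>) + (\<Sum>g\<in>F - ?K. \<bar>p g\<bar>)"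
    by (rule order_trans[OF abs_triangle_ineq4 add_mono]) (rule sum_abs)+
  also have "\<dots> = (\<Sum>g\<in>sym_diff ?K F. \<bar>p g\<bar>)"
    using assms(1) by (subst sum.union_disjoint) auto
  also have "\<dots> \<le> M * real (card (sym_diff ?K F))"
    using sum_bounded_above[of "sym_diff ?K F" "\<lambda>g. \<bar>p g\<bar>" M] assms(2) by (simp add: mult.commute)
  finally have "\<bar>(\<Sum>g\<in>F. p (k + g)) - sum p F\<bar> / real (card F)
      \<le> M * real (card (sym_diff ?K F)) / real (card F)"
    unfolding eq by (simp add: divide_right_mono)
  then show ?thesis
    by (simp add: mean_def diff_divide_distrib[symmetric])
qed

lemma folner_sequence_finite: "folner_sequence F \<Longrightarrow> finite (F n)"
  and folner_sequence_nonempty: "folner_sequence F \<Longrightarrow> F n \<noteq> {}"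
  by (auto simp: folner_sequence_def)

lemma folner_mean_translate:
  fixes p :: "'g::group_add \<Rightarrow> real"
  assumes F: "folner_sequence F" and "\<And>g. \<bar>p g\<bar> \<le> M"
  shows "(\<lambda>n. mean (F n) (\<lambda>g. p (k + g)) - mean (F n) p) \<longlonglongrightarrow> 0"
proof (rule Lim_null_comparison)
  show "\<forall>\<^sub>F n in sequentially. norm (mean (F n) (\<lambda>g. p (k + g)) - mean (F n) p)
      \<le> M * (real (card (sym_diff ((+) k ` F n) (F n))) / real (card (F n)))"
    using mean_translate_diff_le[OF folner_sequence_finite[OF F], of p M] assms(2) by simp
  show "(\<lambda>n. M * (real (card (sym_diff ((+) k ` F n) (F n))) / real (card (F n)))) \<longlonglongrightarrow> 0"
    using F unfolding folner_sequence_def by (intro tendsto_mult_right_zero) blast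
qed

section \<open>Equidistribution of a group in its compactification\<close>

locale group_compactification_with_haar =
  fixes \<tau> :: "'g::group_add \<Rightarrow> 'h::{topological_group_add, metric_space}"
    and \<nu> :: "'h measure"
  assumes compactification: "metric_group_compactification \<tau>"
    and haar: "normalized_haar_measure \<nu>"
begin

lemma compact_UNIV: "compact (UNIV :: 'h set)"
  and \<tau>_add: "\<tau> (g + g') = \<tau> g + \<tau> g'"
  and dense_range: "closure (range \<tau>) = UNIV"
  using compactification by (auto simp: metric_group_compactification_def)

lemma sets_\<nu> [measurable_cong, simp]: "sets \<nu> = sets borel"
  using haar by (simp add: normalized_haar_measure_def)

lemma space_\<nu> [simp]: "space \<nu> = UNIV"
  using sets_eq_imp_space_eq[OF sets_\<nu>] by simp

lemma emeasure_UNIV: "emeasure \<nu> UNIV = 1"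
  using haar by (simp add: normalized_haar_measure_def)

sublocale finite_measure \<nu>
  by (rule finite_measureI) (simp add: emeasure_UNIV)

lemma measure_UNIV: "measure \<nu> UNIV = 1"
  by (simp add: measure_def emeasure_UNIV)

lemma continuous_bounded:
  fixes q :: "'h \<Rightarrow> real"
  assumes "continuous_on UNIV q"
  obtains M where "\<And>x. \<bar>q x\<bar> \<le> M"
  using compact_imp_bounded[OF compact_continuous_image[OF assms compact_UNIV]]
  by (auto simp: bounded_iff)

lemma continuous_measurable:
  "continuous_on UNIV (q :: 'h \<Rightarrow> real) \<Longrightarrow> q \<in> borel_measurable \<nu>"
  using borel_measurable_continuous_onI[of q] by (simp cong: measurable_cong_sets)

lemma continuous_integrable:
  fixes q :: "'h \<Rightarrow> real"
  assumes "continuous_on UNIV q"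
  shows "integrable \<nu> q"
proof -
  obtain M where "\<And>x. \<bar>q x\<bar> \<le> M" using continuous_bounded[OF assms] by blast
  then show ?thesis
    using continuous_measurable[OF assms] by (intro integrable_const_bound[of _ M]) auto
qed

lemma continuous_translate:
  "continuous_on UNIV (q :: 'h \<Rightarrow> real) \<Longrightarrow> continuous_on UNIV (\<lambda>x. q (a + x))"
  "continuous_on UNIV (q :: 'h \<Rightarrow> real) \<Longrightarrow> continuous_on UNIV (\<lambda>x. q (x + a))"
  "continuous_on UNIV (q :: 'h \<Rightarrow> real) \<Longrightarrow> continuous_on UNIV (\<lambda>x. q (- x))"
  by (erule continuous_on_compose2, intro continuous_intros, simp)+

lemma integral_translate:
  fixes q :: "'h \<Rightarrow> real"
  assumes "continuous_on UNIV q"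
  shows "(\<integral>x. q (a + x) \<partial>\<nu>) = (\<integral>x. q x \<partial>\<nu>)"
proof -
  have [measurable]: "(+) a \<in> borel_measurable (borel :: 'h measure)"
    by (intro borel_measurable_continuous_onI continuous_intros)
  then have meas: "(+) a \<in> measurable \<nu> \<nu>"
    by (simp cong: measurable_cong_sets)
  have "distr \<nu> \<nu> ((+) a) = \<nu>"
  proof (rule measure_eqI)
    fix A assume "A \<in> sets (distr \<nu> \<nu> ((+) a))"
    then have A: "A \<in> sets borel" by simp
    have "(+) a -` A = (+) (- a) ` A"
      by (auto simp: image_iff add.assoc[symmetric] intro!: bexI[of _ "a + _"])
    then show "emeasure (distr \<nu> \<nu> ((+) a)) A = emeasure \<nu> A"
      using A haar meas by (simp add: emeasure_distr normalized_haar_measure_def)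
  qed simp
  then have "(\<integral>x. q x \<partial>\<nu>) = (\<integral>x. q x \<partial>distr \<nu> \<nu> ((+) a))" by simp
  also have "\<dots> = (\<integral>x. q (a + x) \<partial>\<nu>)"
    using meas continuous_measurable[OF assms] by (rule integral_distr)
  finally show ?thesis by simp
qed

text \<open>For \<open>h\<close> in the range of \<open>\<tau>\<close> this is the Folner property. A general \<open>h\<close> is
  approximated by such points, and since addition is uniformly continuous on the compact space
  \<open>H \<times> H\<close>, the error made in \<open>q\<close> is uniform in the other argument, hence survives averaging.\<close>

lemma mean_translate_asymptotically_invariant:
  fixes q :: "'h \<Rightarrow> real"
  assumes F: "folner_sequence F" and q: "continuous_on UNIV q"
  shows "(\<lambda>n. mean (F n) (\<lambda>g. q (h + \<tau> g)) - mean (F n) (\<lambda>g. q (\<tau> g))) \<longlonglongrightarrow> 0"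
proof (rule LIMSEQ_I)
  fix e :: real assume "e > 0"
  have "continuous_on (UNIV \<times> UNIV) (\<lambda>z. q (fst z + snd z))"
    by (rule continuous_on_compose2[OF q], intro continuous_intros, simp)
  then have "uniformly_continuous_on (UNIV \<times> UNIV) (\<lambda>z. q (fst z + snd z))"
    using compact_Times[OF compact_UNIV compact_UNIV] by (rule compact_uniformly_continuous)
  then obtain d where "d > 0" and d: "\<And>z z'. dist z' z < d \<Longrightarrow>
      dist (q (fst z' + snd z')) (q (fst z + snd z)) < e / 2"
    unfolding uniformly_continuous_on_def using \<open>e > 0\<close>
    by (metis UNIV_I UNIV_Times_UNIV half_gt_zero)
  \<comment> \<open>The translate by \<open>h\<close> is within \<open>e / 2\<close> of the one by \<open>\<tau> k\<close>, to which the Folner property applies.\<close>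
  obtain k where k: "dist (\<tau> k) h < d"
    using dense_range \<open>d > 0\<close> closure_approachable[of h "range \<tau>"] by auto
  have close: "\<bar>q (h + x) - q (\<tau> k + x)\<bar> \<le> e / 2" for x
    using d[of "(h, x)" "(\<tau> k, x)"] k by (simp add: dist_Pair_Pair dist_real_def dist_commute)
  obtain M where M: "\<And>x. \<bar>q x\<bar> \<le> M" using continuous_bounded[OF q] by blast
  have "(\<lambda>n. mean (F n) (\<lambda>g. q (\<tau> (k + g))) - mean (F n) (\<lambda>g. q (\<tau> g))) \<longlonglongrightarrow> 0"
    using folner_mean_translate[OF F, of "\<lambda>g. q (\<tau> g)" M k] M by simp
  then obtain N where N: "\<And>n. n \<ge> N \<Longrightarrow>
      \<bar>mean (F n) (\<lambda>g. q (\<tau> (k + g))) - mean (F n) (\<lambda>g. q (\<tau> g))\<bar> < e / 2"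
    using LIMSEQ_D[of _ 0 "e / 2"] \<open>e > 0\<close> by fastforce
  have "\<bar>mean (F n) (\<lambda>g. q (h + \<tau> g)) - mean (F n) (\<lambda>g. q (\<tau> g))\<bar> < e" if "n \<ge> N" for n
  proof -
    have "\<bar>mean (F n) (\<lambda>g. q (h + \<tau> g) - q (\<tau> (k + g)))\<bar> \<le> e / 2"
      using F close by (intro abs_mean_le) (auto simp: folner_sequence_def \<tau>_add)
    then show ?thesis using N[OF that] unfolding mean_diff by linarith
  qed
  then show "\<exists>N. \<forall>n\<ge>N. norm (mean (F n) (\<lambda>g. q (h + \<tau> g)) - mean (F n) (\<lambda>g. q (\<tau> g)) - 0) < e"
    by auto
qed

lemma continuous_mean:
  assumes "\<And>g. continuous_on UNIV (\<lambda>x. q g x)"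
  shows "continuous_on UNIV (\<lambda>x. mean E (\<lambda>g. q g x))"
  unfolding mean_def divide_inverse using assms by (intro continuous_intros)

lemma integral_mean:
  assumes "\<And>g. continuous_on UNIV (\<lambda>x :: 'h. q g x)"
  shows "(\<integral>x. mean E (\<lambda>g. q g x) \<partial>\<nu>) = mean E (\<lambda>g. \<integral>x. q g x \<partial>\<nu>)"
  using assms by (simp add: mean_def continuous_integrable Bochner_Integration.integral_sum)

lemma integral_tendsto_bounded:
  fixes s :: "nat \<Rightarrow> 'h \<Rightarrow> real"
  assumes "\<And>n. continuous_on UNIV (s n)" and "\<And>n x. \<bar>s n x\<bar> \<le> M"
    and "\<And>x. (\<lambda>n. s n x) \<longlonglongrightarrow> u x" and "u \<in> borel_measurable \<nu>"
  shows "(\<lambda>n. \<integral>x. s n x \<partial>\<nu>) \<longlonglongrightarrow> (\<integral>x. u x \<partial>\<nu>)"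
proof (rule integral_dominated_convergence[where w = "\<lambda>_. M"])
  show "s n \<in> borel_measurable \<nu>" for n by (rule continuous_measurable[OF assms(1)])
qed (use assms in simp_all)

text \<open>The mean over \<open>g\<close> of \<open>q (- h + \<tau> g)\<close> has, as a function of \<open>h\<close>, the exact integral
  \<open>\<integral> q (- x) d\<nu>\<close>, because \<open>- h + \<tau> g = - (- \<tau> g + h)\<close> and \<open>\<nu>\<close> is left
  invariant; on the other hand it is asymptotically independent of \<open>h\<close>.\<close>

lemma mean_tendsto_integral_uminus:
  fixes q :: "'h \<Rightarrow> real"
  assumes F: "folner_sequence F" and q: "continuous_on UNIV q"
  shows "(\<lambda>n. mean (F n) (\<lambda>g. q (\<tau> g))) \<longlonglongrightarrow> (\<integral>x. q (- x) \<partial>\<nu>)"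
proof -
  obtain M where M: "\<And>x. \<bar>q x\<bar> \<le> M" using continuous_bounded[OF q] by blast
  let ?s = "\<lambda>n h. mean (F n) (\<lambda>g. q (- h + \<tau> g))"
  let ?c = "\<lambda>n. mean (F n) (\<lambda>g. q (\<tau> g))"
  have cont: "continuous_on UNIV (\<lambda>h. q (- h + \<tau> g))" for g
    by (rule continuous_on_compose2[OF q], intro continuous_intros, simp)
  have cont_s: "continuous_on UNIV (?s n)" for n
    by (rule continuous_mean) (rule cont)
  have bound: "\<bar>?s n h\<bar> \<le> M" "\<bar>?c n\<bar> \<le> M" for n h
    using F M by (auto intro!: abs_mean_le simp: folner_sequence_def)
  have int_s: "(\<integral>h. ?s n h \<partial>\<nu>) = (\<integral>x. q (- x) \<partial>\<nu>)" for n
  proof -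
    have "(\<integral>h. q (- h + \<tau> g) \<partial>\<nu>) = (\<integral>x. q (- x) \<partial>\<nu>)" for g
      using integral_translate[OF continuous_translate(3)[OF q], of "- \<tau> g"]
      by (simp add: minus_add)
    then have "(\<integral>h. ?s n h \<partial>\<nu>) = mean (F n) (\<lambda>_. \<integral>x. q (- x) \<partial>\<nu>)"
      using integral_mean[of "\<lambda>g h. q (- h + \<tau> g)", OF cont] by simp
    then show ?thesis
      by (simp add: mean_const folner_sequence_finite[OF F] folner_sequence_nonempty[OF F])
  qed
  have "(\<lambda>n. \<integral>h. ?s n h - ?c n \<partial>\<nu>) \<longlonglongrightarrow> (\<integral>h. 0 \<partial>\<nu>)"
  proof (rule integral_tendsto_bounded)
    show "continuous_on UNIV (\<lambda>h. ?s n h - ?c n)" for n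
      using cont_s by (intro continuous_intros)
    show "\<bar>?s n h - ?c n\<bar> \<le> M + M" for n h
      by (rule order_trans[OF abs_triangle_ineq4 add_mono]) (rule bound)+
    show "(\<lambda>n. ?s n h - ?c n) \<longlonglongrightarrow> 0" for h
      by (rule mean_translate_asymptotically_invariant[OF F q])
  qed simp
  moreover have "(\<integral>h. ?s n h - ?c n \<partial>\<nu>) = (\<integral>x. q (- x) \<partial>\<nu>) - ?c n" for n
    by (subst Bochner_Integration.integral_diff)
       (simp_all add: continuous_integrable[OF cont_s] int_s measure_UNIV)
  ultimately have "(\<lambda>n. (\<integral>x. q (- x) \<partial>\<nu>) - ?c n) \<longlonglongrightarrow> 0" by simp
  from tendsto_diff[OF tendsto_const[of "\<integral>x. q (- x) \<partial>\<nu>"] this] show ?thesis by simp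
qed

text \<open>Left invariance forces inversion invariance. The means of \<open>q (\<tau> g + h)\<close> have
  integral \<open>\<integral> q d\<nu>\<close> in \<open>h\<close>, whereas for each fixed \<open>h\<close> they converge to
  \<open>\<integral> q (- x + h) d\<nu>(x)\<close>, which equals \<open>\<integral> q (- x) d\<nu>(x)\<close> since
  \<open>- x + h = - (- h + x)\<close>. A Folner sequence thus replaces the Fubini argument by which
  unimodularity of compact groups is usually shown.\<close>

lemma integral_uminus:
  fixes q :: "'h \<Rightarrow> real" and F :: "nat \<Rightarrow> 'g set"
  assumes F: "folner_sequence F" and q: "continuous_on UNIV q"
  shows "(\<integral>x. q (- x) \<partial>\<nu>) = (\<integral>x. q x \<partial>\<nu>)"
proof -
  obtain M where M: "\<And>x. \<bar>q x\<bar> \<le> M" using continuous_bounded[OF q] by blast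
  let ?s = "\<lambda>n h. mean (F n) (\<lambda>g. q (\<tau> g + h))"
  have "(\<lambda>n. \<integral>h. ?s n h \<partial>\<nu>) \<longlonglongrightarrow> (\<integral>h. (\<integral>x. q (- x) \<partial>\<nu>) \<partial>\<nu>)"
  proof (rule integral_tendsto_bounded)
    show "continuous_on UNIV (?s n)" for n
      by (rule continuous_mean) (rule continuous_translate(1)[OF q])
    show "\<bar>?s n h\<bar> \<le> M" for n h
      using F M by (auto intro!: abs_mean_le simp: folner_sequence_def)
    show "(\<lambda>n. ?s n h) \<longlonglongrightarrow> (\<integral>x. q (- x) \<partial>\<nu>)" for h
      using mean_tendsto_integral_uminus[OF F continuous_translate(2)[OF q, of h]]
        integral_translate[OF continuous_translate(3)[OF q], of "- h"]
      by (simp add: minus_add)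
  qed simp
  moreover have "(\<integral>h. ?s n h \<partial>\<nu>) = (\<integral>x. q x \<partial>\<nu>)" for n
    using integral_mean[of "\<lambda>g h. q (\<tau> g + h)" "F n", OF continuous_translate(1)[OF q]]
    by (simp add: integral_translate[OF q] mean_const folner_sequence_finite[OF F]
          folner_sequence_nonempty[OF F])
  ultimately have "(\<lambda>n::nat. \<integral>x. q x \<partial>\<nu>) \<longlonglongrightarrow> (\<integral>x. q (- x) \<partial>\<nu>)"
    by (simp add: measure_UNIV)
  then show ?thesis by (simp add: LIMSEQ_const_iff)
qed

lemma mean_tendsto_integral:
  fixes q :: "'h \<Rightarrow> real"
  assumes "folner_sequence F" and "continuous_on UNIV q"
  shows "(\<lambda>n. mean (F n) (\<lambda>g. q (\<tau> g))) \<longlonglongrightarrow> (\<integral>x. q x \<partial>\<nu>)"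
  using mean_tendsto_integral_uminus[OF assms] integral_uminus[OF assms] by simp

section \<open>Frequencies of visits\<close>

abbreviation frequency :: "'g set \<Rightarrow> 'h set \<Rightarrow> real" where
  "frequency E S \<equiv> mean E (\<lambda>g. indicator S (\<tau> g))"

text \<open>This is one implication of the portmanteau theorem. A nonempty closed set is the decreasing limit of the
  continuous functions \<open>max 0 (1 - m * infdist x C)\<close>, and the mean of each bounds the frequency from
  above.\<close>

lemma eventually_frequency_closed_less:
  assumes F: "folner_sequence F" and C: "closed C" and "measure \<nu> C < c"
  shows "\<forall>\<^sub>F n in sequentially. frequency (F n) C < c"
proof (cases "C = {}")
  case True
  then show ?thesis using assms(3) by (simp add: mean_def)
next
  case False
  let ?f = "\<lambda>m x :: 'h. max 0 (1 - real m * infdist x C) :: real"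
  have cont: "continuous_on UNIV (?f m)" for m by (intro continuous_intros)
  have "(\<lambda>m. \<integral>x. ?f m x \<partial>\<nu>) \<longlonglongrightarrow> (\<integral>x. indicator C x \<partial>\<nu>)"
  proof (rule integral_tendsto_bounded[OF cont, where M = 1])
    show "\<bar>?f m x\<bar> \<le> 1" for m x using infdist_nonneg[of x C] by auto
    show "(\<lambda>m. ?f m x) \<longlonglongrightarrow> indicator C x" for x
    proof (cases "x \<in> C")
      case True then show ?thesis by simp
    next
      case out: False
      then have pos: "infdist x C > 0"
        using C False in_closed_iff_infdist_zero[of C x] infdist_nonneg[of x C] by linarith
      then obtain N :: nat where N: "1 < real N * infdist x C"
        using reals_Archimedean3[OF pos] by blast
      have "?f m x = 0" if "m \<ge> N" for m
      proof -
        have "real N * infdist x C \<le> real m * infdist x C"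
          using that pos by (intro mult_right_mono) auto
        then show ?thesis using N by auto
      qed
      then have "\<forall>\<^sub>F m in sequentially. ?f m x = 0"
        by (auto simp: eventually_sequentially)
      then show ?thesis using out by (simp add: tendsto_eventually)
    qed
    show "(indicator C :: 'h \<Rightarrow> real) \<in> borel_measurable \<nu>"
      using C by (intro borel_measurable_indicator) simp
  qed
  then have "(\<lambda>m. \<integral>x. ?f m x \<partial>\<nu>) \<longlonglongrightarrow> measure \<nu> C"
    using C by simp
  then have "\<forall>\<^sub>F m in sequentially. (\<integral>x. ?f m x \<partial>\<nu>) < c"
    using assms(3) by (rule order_tendstoD)
  then obtain m where "(\<integral>x. ?f m x \<partial>\<nu>) < c"
    by (auto simp: eventually_sequentially)
  then have "\<forall>\<^sub>F n in sequentially. mean (F n) (\<lambda>g. ?f m (\<tau> g)) < c"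
    using mean_tendsto_integral[OF F cont] by (rule order_tendstoD(2)[rotated])
  moreover have "frequency (F n) C \<le> mean (F n) (\<lambda>g. ?f m (\<tau> g))" for n
    by (intro mean_mono) (auto simp: indicator_def)
  ultimately show ?thesis
    by (auto elim!: eventually_mono intro: le_less_trans)
qed

lemma frequency_mono: "S \<subseteq> T \<Longrightarrow> frequency E S \<le> frequency E T"
  by (intro mean_mono) (auto simp: indicator_def)

lemma frequency_Compl:
  assumes "finite E" "E \<noteq> {}"
  shows "frequency E (- S) = 1 - frequency E S"
proof -
  have "frequency E (- S) = mean E (\<lambda>g. 1 - indicator S (\<tau> g))"
    by (rule arg_cong[of _ _ "mean E"]) (auto simp: indicator_def)
  then show ?thesis using assms by (simp add: mean_diff mean_const)
qed

lemma limsup_frequency_le: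
  assumes F: "folner_sequence F"
  shows "limsup (\<lambda>n. ereal (frequency (F n) S)) \<le> ereal (measure \<nu> (closure S))"
proof (rule ereal_le_epsilon2)
  fix e :: real assume "e > 0"
  then have "\<forall>\<^sub>F n in sequentially. frequency (F n) (closure S) < measure \<nu> (closure S) + e"
    by (intro eventually_frequency_closed_less[OF F]) auto
  then have "\<forall>\<^sub>F n in sequentially.
      ereal (frequency (F n) S) \<le> ereal (measure \<nu> (closure S) + e)"
    by eventually_elim (use frequency_mono[OF closure_subset[of S]] in \<open>fastforce intro: order_trans\<close>)
  then show "limsup (\<lambda>n. ereal (frequency (F n) S)) \<le> ereal (measure \<nu> (closure S)) + ereal e"
    by (simp add: Limsup_bounded)
qed

text \<open>The boundary being null, the closures of \<open>S\<close> and of its complement have the same measure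
  as these sets themselves, so the bounds for closed sets are sharp on both sides.\<close>

lemma frequency_tendsto_measure:
  assumes F: "folner_sequence F" and S: "S \<in> regular_windows \<nu>"
  shows "(\<lambda>n. frequency (F n) S) \<longlonglongrightarrow> measure \<nu> S"
proof (rule order_tendstoI)
  have meas: "S \<in> sets borel" and null: "measure \<nu> (frontier S) = 0"
    using S by (auto simp: regular_windows_def)
  have le: "measure \<nu> (closure T) \<le> measure \<nu> T" if "T \<in> sets borel" "frontier T = frontier S" for T
  proof -
    have "measure \<nu> (closure T) \<le> measure \<nu> (T \<union> frontier T)"
      using that(1) interior_subset[of T]
      by (intro finite_measure_mono sets.Un) (auto simp: frontier_def)
    also have "\<dots> \<le> measure \<nu> T + measure \<nu> (frontier T)"
      using that by (intro measure_Un_le) auto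
    finally show ?thesis using that null by simp
  qed
  {
    fix c assume "measure \<nu> S < c"
    then have "measure \<nu> (closure S) < c" using le[OF meas] by simp
    from eventually_frequency_closed_less[OF F closed_closure this]
    show "\<forall>\<^sub>F n in sequentially. frequency (F n) S < c"
      by eventually_elim (use frequency_mono[OF closure_subset] in \<open>fastforce intro: le_less_trans\<close>)
  next
    fix c assume "c < measure \<nu> S"
    \<comment> \<open>The lower bound is the upper bound for the complement, which has the same boundary.\<close>
    moreover have "measure \<nu> (closure (- S)) \<le> measure \<nu> (- S)"
      using meas by (intro le) auto
    moreover have "measure \<nu> (- S) = 1 - measure \<nu> S"
      using finite_measure_compl[of S] meas by (simp add: measure_UNIV Compl_eq_Diff_UNIV)
    ultimately have "measure \<nu> (closure (- S)) < 1 - c" by simp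
    from eventually_frequency_closed_less[OF F closed_closure this]
    show "\<forall>\<^sub>F n in sequentially. c < frequency (F n) S"
    proof eventually_elim
      case (elim n)
      then have "frequency (F n) (- S) < 1 - c"
        using frequency_mono[OF closure_subset[of "- S"], of "F n"] by linarith
      then show ?case
        using frequency_Compl[of "F n" S] folner_sequence_finite[OF F] folner_sequence_nonempty[OF F]
        by simp
    qed
  }
qed

section \<open>Distances between codings\<close>

lemma besicovitch_coding:
  assumes "folner_sequence F"
  shows "besicovitch F (coding \<tau> A) (coding \<tau> B)
    = real_of_ereal (limsup (\<lambda>n. ereal (frequency (F n) (sym_diff A B))))"
proof -
  have "{g \<in> F n. coding \<tau> A g \<noteq> coding \<tau> B g} = {g \<in> F n. \<tau> g \<in> sym_diff A B}" for n
    by (auto simp: coding_def indicator_def split: if_splits)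
  then show ?thesis
    by (simp add: besicovitch_def mean_indicator folner_sequence_finite[OF assms])
qed

lemma besicovitch_coding_le:
  assumes F: "folner_sequence F"
  shows "besicovitch F (coding \<tau> A) (coding \<tau> B) \<le> window_closure_dist \<nu> A B"
proof -
  let ?L = "limsup (\<lambda>n. ereal (frequency (F n) (sym_diff A B)))"
  have "?L \<le> ereal (measure \<nu> (closure (sym_diff A B)))"
    by (rule limsup_frequency_le[OF F])
  then show ?thesis
    unfolding besicovitch_coding[OF F] window_closure_dist_def
    by (cases ?L) auto
qed

lemma regular_windows_sym_diff:
  assumes "A \<in> regular_windows \<nu>" "B \<in> regular_windows \<nu>"
  shows "sym_diff A B \<in> regular_windows \<nu>"
proof -
  have meas: "A \<in> sets borel" "B \<in> sets borel"
    and null: "measure \<nu> (frontier A) = 0" "measure \<nu> (frontier B) = 0"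
    using assms by (auto simp: regular_windows_def)
  have "frontier (sym_diff A B) \<subseteq> frontier A \<union> frontier B"
    using frontier_Un_subset[of "A - B" "B - A"] frontier_Int_subset[of A "- B"]
      frontier_Int_subset[of B "- A"] by (auto simp: Diff_eq)
  then have "measure \<nu> (frontier (sym_diff A B)) \<le> measure \<nu> (frontier A \<union> frontier B)"
    by (intro finite_measure_mono) auto
  also have "\<dots> \<le> measure \<nu> (frontier A) + measure \<nu> (frontier B)"
    by (intro measure_Un_le) auto
  finally have "measure \<nu> (frontier (sym_diff A B)) = 0"
    using null measure_nonneg[of \<nu> "frontier (sym_diff A B)"] by linarith
  then show ?thesis using meas by (simp add: regular_windows_def)
qed

lemma besicovitch_coding_eq:
  assumes F: "folner_sequence F" and "A \<in> regular_windows \<nu>" "B \<in> regular_windows \<nu>"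
  shows "besicovitch F (coding \<tau> A) (coding \<tau> B) = window_dist \<nu> A B"
proof -
  have "(\<lambda>n. ereal (frequency (F n) (sym_diff A B))) \<longlonglongrightarrow> ereal (measure \<nu> (sym_diff A B))"
    using frequency_tendsto_measure[OF F regular_windows_sym_diff[OF assms(2,3)]] by simp
  from lim_imp_Limsup[OF sequentially_bot this] show ?thesis
    unfolding besicovitch_coding[OF F] window_dist_def by (simp only: real_of_ereal.simps)
qed

section \<open>The two pseudometrics on windows\<close>

lemma pseudometric_window_dist: "pseudometric_on (sets borel) (window_dist \<nu>)"
proof -
  have "measure \<nu> (sym_diff A C) \<le> measure \<nu> (sym_diff A B) + measure \<nu> (sym_diff B C)"
    if "A \<in> sets borel" "B \<in> sets borel" "C \<in> sets borel" for A B C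
  proof -
    have "measure \<nu> (sym_diff A C) \<le> measure \<nu> (sym_diff A B \<union> sym_diff B C)"
      using that by (intro finite_measure_mono) auto
    also have "\<dots> \<le> measure \<nu> (sym_diff A B) + measure \<nu> (sym_diff B C)"
      using that by (intro measure_Un_le) auto
    finally show ?thesis .
  qed
  then show ?thesis
    by (auto simp: pseudometric_on_def window_dist_def Un_commute)
qed

lemma pseudometric_window_closure_dist: "pseudometric_on (sets borel) (window_closure_dist \<nu>)"
proof -
  have "window_closure_dist \<nu> A C \<le> window_closure_dist \<nu> A B + window_closure_dist \<nu> B C" for A B C
  proof -
    have "closure (sym_diff A C) \<subseteq> closure (sym_diff A B \<union> sym_diff B C)"
      by (rule closure_mono) auto
    then have "measure \<nu> (closure (sym_diff A C))
        \<le> measure \<nu> (closure (sym_diff A B) \<union> closure (sym_diff B C))"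
      by (intro finite_measure_mono) (auto simp: closure_Un)
    also have "\<dots> \<le> measure \<nu> (closure (sym_diff A B)) + measure \<nu> (closure (sym_diff B C))"
      by (intro measure_Un_le) auto
    finally show ?thesis unfolding window_closure_dist_def .
  qed
  moreover have "window_closure_dist \<nu> A B = window_closure_dist \<nu> B A" for A B
    unfolding window_closure_dist_def by (simp only: Un_commute)
  moreover have "0 \<le> window_closure_dist \<nu> A B" "window_closure_dist \<nu> A A = 0" for A B
    by (simp_all add: window_closure_dist_def)
  ultimately show ?thesis
    unfolding pseudometric_on_def by blast
qed

end

section \<open>Continuity and isometry of the coding\<close>

lemma pseudometric_continuous_on_if_nonexpansive:
  assumes "\<And>x y. x \<in> S \<Longrightarrow> y \<in> S \<Longrightarrow> e (f x) (f y) \<le> d x y"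
  shows "pseudometric_continuous_on S d e f"
  unfolding pseudometric_continuous_on_def using assms by (meson le_less_trans)

theorem theorem1p1:
  fixes \<tau> :: "'g::group_add \<Rightarrow> 'h::{topological_group_add, metric_space}"
    and \<nu> :: "'h measure"
  assumes "countable (UNIV :: 'g set)" and "infinite (UNIV :: 'g set)"
    and "amenable_group TYPE('g)"
    and "metric_group_compactification \<tau>"
    and "normalized_haar_measure \<nu>"
  shows "pseudometric_on (sets borel) (window_dist \<nu>) \<and>
    pseudometric_on (sets borel) (window_closure_dist \<nu>) \<and>
    (\<forall>F :: nat \<Rightarrow> 'g set. folner_sequence F \<longrightarrow>
       pseudometric_continuous_on (sets borel) (window_closure_dist \<nu>) (besicovitch F) (coding \<tau>) \<and>
       pseudometric_isometry_on (regular_windows \<nu>) (window_dist \<nu>) (besicovitch F) (coding \<tau>)) \<and>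
    pseudometric_continuous_on (sets borel) (window_closure_dist \<nu>) weyl (coding \<tau>) \<and>
    pseudometric_isometry_on (regular_windows \<nu>) (window_dist \<nu>) weyl (coding \<tau>)"
proof -
  interpret group_compactification_with_haar \<tau> \<nu>
    by unfold_locales (rule assms)+
  have ne: "{F :: nat \<Rightarrow> 'g set. folner_sequence F} \<noteq> {}"
    using assms(3) by (auto simp: amenable_group_def)
  have weyl_le: "weyl (coding \<tau> A) (coding \<tau> B) \<le> window_closure_dist \<nu> A B" for A B
    unfolding weyl_def using besicovitch_coding_le by (intro cSUP_least[OF ne]) auto
  have weyl_eq: "weyl (coding \<tau> A) (coding \<tau> B) = window_dist \<nu> A B"
    if "A \<in> regular_windows \<nu>" "B \<in> regular_windows \<nu>" for A B
    unfolding weyl_def using besicovitch_coding_eq[OF _ that] ne by simp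
  show ?thesis
    using pseudometric_window_dist pseudometric_window_closure_dist
    by (auto intro!: pseudometric_continuous_on_if_nonexpansive besicovitch_coding_le weyl_le
        simp: pseudometric_isometry_on_def besicovitch_coding_eq weyl_eq)
qed

end
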